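(* Let $k_\mathcal{G}=n_\mathcal{G}\ge1$ and $k_\mathcal{H}=n_\mathcal{H}\ge1$. Then the polynomials $s_g=0$ for $g\in V(\mathcal{G})$ form a $0$-sum-of-squares certificate of $f_{\mathrm{viz}}$, i.e. $f_{\mathrm{viz}}\equiv\sum_{g\in V(\mathcal{G})}s_g^2=0\pmod{I_{\mathrm{viz}}}$; consequently Vizing's inequality $\gamma(G)\gamma(H)\le\gamma(G\Box H)$ holds for all graphs $G$ with $\gamma(G)=|V(G)|=n_\mathcal{G}$ and $H$ with $\gamma(H)=|V(H)|=n_\mathcal{H}$.
   Context: $\mathbb{K}$ is a subfield of $\mathbb{R}$. $V(\mathcal{G})$ is a set of $n_\mathcal{G}$ vertices with fixed subset $D_\mathcal{G}$ of size $k_\mathcal{G}$; $V(\mathcal{H})$ a disjoint set of $n_\mathcal{H}$ vertices with fixed subset $D_\mathcal{H}$ of size $k_\mathcal{H}$. Variables $e_{gg'}=e_{g'g}$ for 2-subsets of $V(\mathcal{G})$, $e_{hh'}$ for 2-subsets of $V(\mathcal{H})$, $x_{gh}$ for $g\in V(\mathcal{G}),h\in V(\mathcal{H})$; $P$ is the polynomial ring over $\mathbb{K}$ in these. $I_{\mathrm{viz}}\subseteq P$ is generated by: $e_{gg'}^2-e_{gg'}$; $\prod_{g'\in D_\mathcal{G}}(1-e_{gg'})$ for $g\in V(\mathcal{G})\setminus D_\mathcal{G}$; $\prod_{g'\in V(\mathcal{G})\setminus S}\sum_{g\in S}e_{gg'}$ for $S\subseteq V(\mathcal{G})$, $|S|=k_\mathcal{G}-1$;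 the same three families for $\mathcal{H}$; $x_{gh}^2-x_{gh}$; and $(1-x_{gh})\prod_{g'\ne g}(1-e_{gg'}x_{g'h})\prod_{h'\ne h}(1-e_{hh'}x_{gh'})$ for all $g,h$. $f_{\mathrm{viz}}=\sum_{g,h}x_{gh}-k_\mathcal{G}k_\mathcal{H}$. $\gamma(\cdot)$ is the domination number, $G\Box H$ the Cartesian product graph. An $\ell$-sum-of-squares certificate of $f$ modulo $I$ is a family $s_i$ of polynomials of degree $\le\ell$ with $f-\sum s_i^2\in I$. *)

theory Defs
  imports
    "HOL-Algebra.Algebraic_Closure_Type"
    "HOL-Library.Poly_Mapping"
    "Graph_Theory.Pair_Digraph"
begin

section \<open>Polynomials over a subfield of the reals\<close>

text \<open>A polynomial is a finitely supported map from monomials to real coefficients, and a monomial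
  is a finitely supported map from variables to exponents. Addition and multiplication (convolution)
  are the ones of \<^typ>\<open>'a \<Rightarrow>\<^sub>0 'b\<close>.\<close>

type_synonym 'v rpoly = "('v \<Rightarrow>\<^sub>0 nat) \<Rightarrow>\<^sub>0 real"

definition pvar :: "'v \<Rightarrow> 'v rpoly" where
  "pvar v = Poly_Mapping.single (Poly_Mapping.single v 1) 1"

definition polys_over :: "real set \<Rightarrow> 'v set \<Rightarrow> 'v rpoly set" where
  "polys_over K Z = {p. (\<forall>m. Poly_Mapping.lookup p m \<in> K) \<and> (\<forall>m \<in> Poly_Mapping.keys p. Poly_Mapping.keys m \<subseteq> Z)}"

definition poly_ring_over :: "real set \<Rightarrow> 'v set \<Rightarrow> 'v rpoly ring" where
  "poly_ring_over K Z = ring_of_type_algebra\<lparr>carrier := polys_over K Z\<rparr>"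

text \<open>The zero polynomial gets total degree 0.\<close>

definition total_degree :: "'v rpoly \<Rightarrow> nat" where
  "total_degree p =
     Max (insert 0 ((\<lambda>m. \<Sum>v\<in>Poly_Mapping.keys m. Poly_Mapping.lookup m v) ` Poly_Mapping.keys p))"

definition sos_certificate ::
    "'v rpoly ring \<Rightarrow> 'v rpoly set \<Rightarrow> nat \<Rightarrow> 'v rpoly \<Rightarrow> 'i set \<Rightarrow> ('i \<Rightarrow> 'v rpoly) \<Rightarrow> bool" where
  "sos_certificate P J l f A s \<longleftrightarrow>
     finite A \<and> (\<forall>i\<in>A. s i \<in> carrier P \<and> total_degree (s i) \<le> l) \<and> f - (\<Sum>i\<in>A. (s i)\<^sup>2) \<in> J"

section \<open>The Vizing ideal\<close>

text \<open>Using the 2-subset itself as the index of an edge variable makes it symmetric in its two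
  endpoints. The two vertex sets are disjoint because they are tagged by different constructors
  (and live in different types).\<close>

datatype ('g, 'h) viz_var = EdgeG "'g set" | EdgeH "'h set" | Cross 'g 'h

definition viz_vars :: "'g set \<Rightarrow> 'h set \<Rightarrow> ('g, 'h) viz_var set" where
  "viz_vars VG VH =
     EdgeG ` {e. e \<subseteq> VG \<and> card e = 2} \<union> EdgeH ` {e. e \<subseteq> VH \<and> card e = 2} \<union>
     {Cross g h |g h. g \<in> VG \<and> h \<in> VH}"

definition viz_ring :: "real set \<Rightarrow> 'g set \<Rightarrow> 'h set \<Rightarrow> ('g, 'h) viz_var rpoly ring" where
  "viz_ring K VG VH = poly_ring_over K (viz_vars VG VH)"

definition eG :: "'g \<Rightarrow> 'g \<Rightarrow> ('g, 'h) viz_var rpoly" where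
  "eG g g' = pvar (EdgeG {g, g'})"

definition eH :: "'h \<Rightarrow> 'h \<Rightarrow> ('g, 'h) viz_var rpoly" where
  "eH h h' = pvar (EdgeH {h, h'})"

definition xGH :: "'g \<Rightarrow> 'h \<Rightarrow> ('g, 'h) viz_var rpoly" where
  "xGH g h = pvar (Cross g h)"

text \<open>The three families for one factor, with edge variables \<open>e\<close>: the \<open>e v w\<close> are boolean, \<open>D\<close> is
  dominating, and no set of \<open>k - 1\<close> vertices is dominating. The size condition is written
  \<open>card S + 1 = k\<close> because subtraction on naturals would truncate at \<open>k = 0\<close>.\<close>

definition graph_gens :: "('v \<Rightarrow> 'v \<Rightarrow> 'p::comm_ring_1) \<Rightarrow> 'v set \<Rightarrow> 'v set \<Rightarrow> nat \<Rightarrow> 'p set" where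
  "graph_gens e V D k =
     {(e v w)\<^sup>2 - e v w |v w. v \<in> V \<and> w \<in> V \<and> v \<noteq> w} \<union>
     {(\<Prod>w\<in>D. 1 - e v w) |v. v \<in> V - D} \<union>
     {(\<Prod>w\<in>V - S. \<Sum>v\<in>S. e v w) |S. S \<subseteq> V \<and> card S + 1 = k}"

definition cross_gens :: "'g set \<Rightarrow> 'h set \<Rightarrow> ('g, 'h) viz_var rpoly set" where
  "cross_gens VG VH =
     {(xGH g h)\<^sup>2 - xGH g h |g h. g \<in> VG \<and> h \<in> VH} \<union>
     {(1 - xGH g h) * (\<Prod>g'\<in>VG - {g}. 1 - eG g g' * xGH g' h) * (\<Prod>h'\<in>VH - {h}. 1 - eH h h' * xGH g h')
      |g h. g \<in> VG \<and> h \<in> VH}"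

definition viz_ideal ::
    "real set \<Rightarrow> 'g set \<Rightarrow> 'g set \<Rightarrow> nat \<Rightarrow> 'h set \<Rightarrow> 'h set \<Rightarrow> nat \<Rightarrow> ('g, 'h) viz_var rpoly set" where
  "viz_ideal K VG DG kG VH DH kH =
     Idl\<^bsub>viz_ring K VG VH\<^esub> (graph_gens eG VG DG kG \<union> graph_gens eH VH DH kH \<union> cross_gens VG VH)"

definition viz_poly :: "'g set \<Rightarrow> nat \<Rightarrow> 'h set \<Rightarrow> nat \<Rightarrow> ('g, 'h) viz_var rpoly" where
  "viz_poly VG kG VH kH = (\<Sum>g\<in>VG. \<Sum>h\<in>VH. xGH g h) - of_nat (kG * kH)"

section \<open>Domination number and Cartesian product\<close>

text \<open>Finite simple graphs are the \<^locale>\<open>pair_graph\<close>s: finite, loopless, with symmetric arc relation.\<close>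

definition dominating_set :: "'a pair_pre_digraph \<Rightarrow> 'a set \<Rightarrow> bool" where
  "dominating_set G D \<longleftrightarrow>
     D \<subseteq> pverts G \<and> (\<forall>v \<in> pverts G - D. \<exists>u \<in> D. (u, v) \<in> parcs G)"

definition domination_number :: "'a pair_pre_digraph \<Rightarrow> nat" where
  "domination_number G = Min {card D |D. dominating_set G D}"

definition cartesian_product ::
    "'a pair_pre_digraph \<Rightarrow> 'b pair_pre_digraph \<Rightarrow> ('a \<times> 'b) pair_pre_digraph" where
  "cartesian_product G H =
     \<lparr>pverts = pverts G \<times> pverts H,
      parcs = {((g, h), (g', h')) |g h g' h'.
                 (g = g' \<and> g \<in> pverts G \<and> (h, h') \<in> parcs H) \<or>
                 (h = h' \<and> h \<in> pverts H \<and> (g, g') \<in> parcs G)}\<rparr>"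

section \<open>Well-formedness\<close>

text \<open>\<open>Idl\<close> is an intersection over the ideals of the given structure, so it is the generated ideal
  only if that structure is a ring containing the generators; both facts are established here.\<close>

lemma subfield_real_closed:
  assumes "subfield K (ring_of_type_algebra :: real ring)"
  shows "0 \<in> K" "1 \<in> K" "\<And>a b. a \<in> K \<Longrightarrow> b \<in> K \<Longrightarrow> a + b \<in> K"
    "\<And>a b. a \<in> K \<Longrightarrow> b \<in> K \<Longrightarrow> a * b \<in> K" "\<And>a. a \<in> K \<Longrightarrow> - a \<in> K"
proof -
  interpret R: ring "ring_of_type_algebra :: real ring" by (rule ring_from_type_algebra)
  interpret subring K "ring_of_type_algebra :: real ring"
    using assms by (simp add: subfield_def subdomain_def subcring_def)
  note d = ring_of_type_algebra_def
  show "0 \<in> K" using subringE(2)[OF subring_axioms] by (simp add: d)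
  show "1 \<in> K" using subringE(3)[OF subring_axioms] by (simp add: d)
  show "a + b \<in> K" if "a \<in> K" "b \<in> K" for a b
    using subringE(7)[OF subring_axioms that] by (simp add: d)
  show "a * b \<in> K" if "a \<in> K" "b \<in> K" for a b
    using subringE(6)[OF subring_axioms that] by (simp add: d)
  show "- a \<in> K" if "a \<in> K" for a
  proof -
    have "\<ominus>\<^bsub>ring_of_type_algebra\<^esub> a = - a"
      by (rule R.minus_equality) (auto simp: d)
    then show ?thesis using subringE(5)[OF subring_axioms that] by simp
  qed
qed

context
  fixes K :: "real set"
  assumes K: "subfield K (ring_of_type_algebra :: real ring)"
begin

lemma polys_over_const:
  assumes "c \<in> K" shows "Poly_Mapping.single 0 c \<in> polys_over K Z"
  using assms subfield_real_closed[OF K] by (auto simp: polys_over_def lookup_single when_def)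

lemma polys_over_zero: "0 \<in> polys_over K Z"
  using subfield_real_closed[OF K] by (simp add: polys_over_def)

lemma polys_over_one: "1 \<in> polys_over K Z"
  using subfield_real_closed[OF K] by (auto simp: polys_over_def lookup_one when_def)

lemma polys_over_pvar: "v \<in> Z \<Longrightarrow> pvar v \<in> polys_over K Z"
  using subfield_real_closed[OF K]
  by (auto simp: polys_over_def pvar_def lookup_single when_def)

lemma polys_over_add: "p \<in> polys_over K Z \<Longrightarrow> q \<in> polys_over K Z \<Longrightarrow> p + q \<in> polys_over K Z"
  using subfield_real_closed[OF K] keys_add[of p q]
  by (fastforce simp: polys_over_def lookup_add)

lemma polys_over_uminus: "p \<in> polys_over K Z \<Longrightarrow> - p \<in> polys_over K Z"
  using subfield_real_closed[OF K] by (auto simp: polys_over_def)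

lemma polys_over_diff: "p \<in> polys_over K Z \<Longrightarrow> q \<in> polys_over K Z \<Longrightarrow> p - q \<in> polys_over K Z"
  using polys_over_add[OF _ polys_over_uminus, of p Z q] by simp

lemma polys_over_sum: "(\<And>i. i \<in> A \<Longrightarrow> f i \<in> polys_over K Z) \<Longrightarrow> sum f A \<in> polys_over K Z"
  by (induction A rule: infinite_finite_induct) (auto intro: polys_over_zero polys_over_add)

lemma polys_over_mult:
  assumes p: "p \<in> polys_over K Z" and q: "q \<in> polys_over K Z" shows "p * q \<in> polys_over K Z"
proof -
  have decomp: "r = (\<Sum>m\<in>Poly_Mapping.keys r. Poly_Mapping.single m (Poly_Mapping.lookup r m))"
    for r :: "'a rpoly"
    by (rule poly_mapping_eqI) (auto simp: lookup_sum lookup_single when_def in_keys_iff)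
  have "p * q = (\<Sum>m\<in>Poly_Mapping.keys p. \<Sum>n\<in>Poly_Mapping.keys q.
      Poly_Mapping.single (m + n) (Poly_Mapping.lookup p m * Poly_Mapping.lookup q n))"
    by (subst decomp[of p], subst decomp[of q]) (simp add: sum_product mult_single)
  also have "\<dots> \<in> polys_over K Z"
  proof (intro polys_over_sum)
    fix m n assume mn: "m \<in> Poly_Mapping.keys p" "n \<in> Poly_Mapping.keys q"
    have "Poly_Mapping.keys (m + n) \<subseteq> Z"
      using mn p q keys_add[of m n] unfolding polys_over_def by blast
    then show "Poly_Mapping.single (m + n) (Poly_Mapping.lookup p m * Poly_Mapping.lookup q n)
        \<in> polys_over K Z"
      using p q subfield_real_closed[OF K]
      by (auto simp: polys_over_def lookup_single when_def split: if_splits)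
  qed
  finally show ?thesis .
qed

lemma polys_over_prod: "(\<And>i. i \<in> A \<Longrightarrow> f i \<in> polys_over K Z) \<Longrightarrow> prod f A \<in> polys_over K Z"
  by (induction A rule: infinite_finite_induct) (auto intro: polys_over_one polys_over_mult)

lemma cring_poly_ring_over: "cring (poly_ring_over K Z)"
proof -
  have "\<exists>q\<in>polys_over K Z. p + q = 0" if "p \<in> polys_over K Z" for p
    using polys_over_uminus[OF that] by (intro bexI[of _ "- p"]) auto
  then show ?thesis
    unfolding poly_ring_over_def ring_of_type_algebra_def
    by unfold_locales
      (auto simp: algebra_simps Units_def intro: polys_over_zero polys_over_one polys_over_add polys_over_mult)
qed

lemma graph_gens_carrier:
  assumes "\<And>v w. v \<in> V \<Longrightarrow> w \<in> V \<Longrightarrow> v \<noteq> w \<Longrightarrow> e v w \<in> polys_over K Z" "D \<subseteq> V"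
  shows "graph_gens e V D k \<subseteq> polys_over K Z"
  using assms
  by (auto simp: graph_gens_def power2_eq_square
      intro!: polys_over_diff polys_over_mult polys_over_prod polys_over_sum polys_over_one)

lemma viz_gens_carrier:
  assumes "DG \<subseteq> VG" "DH \<subseteq> VH"
  shows "graph_gens eG VG DG kG \<union> graph_gens eH VH DH kH \<union> cross_gens VG VH \<subseteq> carrier (viz_ring K VG VH)"
proof -
  have e: "\<And>g g'. g \<in> VG \<Longrightarrow> g' \<in> VG \<Longrightarrow> g \<noteq> g' \<Longrightarrow> eG g g' \<in> polys_over K (viz_vars VG VH)"
    "\<And>h h'. h \<in> VH \<Longrightarrow> h' \<in> VH \<Longrightarrow> h \<noteq> h' \<Longrightarrow> eH h h' \<in> polys_over K (viz_vars VG VH)"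
    "\<And>g h. g \<in> VG \<Longrightarrow> h \<in> VH \<Longrightarrow> xGH g h \<in> polys_over K (viz_vars VG VH)"
    by (auto simp: eG_def eH_def xGH_def viz_vars_def intro!: polys_over_pvar)
  have "cross_gens VG VH \<subseteq> polys_over K (viz_vars VG VH)"
    by (auto simp: cross_gens_def power2_eq_square
        intro!: polys_over_diff polys_over_mult polys_over_prod polys_over_one e)
  then show ?thesis
    using graph_gens_carrier[OF e(1) assms(1)] graph_gens_carrier[OF e(2) assms(2)]
    by (simp add: viz_ring_def poly_ring_over_def)
qed

end

lemma pair_graph_cartesian_product:
  assumes "pair_graph G" "pair_graph H"
  shows "pair_graph (cartesian_product G H)"
proof -
  interpret G: pair_graph G by fact
  interpret H: pair_graph H by fact
  have sG: "\<And>a b. (a, b) \<in> parcs G \<Longrightarrow> (b, a) \<in> parcs G"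
    using G.sym_arcs by (auto simp: symmetric_def sym_def)
  have sH: "\<And>a b. (a, b) \<in> parcs H \<Longrightarrow> (b, a) \<in> parcs H"
    using H.sym_arcs by (auto simp: symmetric_def sym_def)
  have sub: "parcs (cartesian_product G H) \<subseteq>
      (pverts G \<times> pverts H) \<times> (pverts G \<times> pverts H)"
    by (auto simp: cartesian_product_def dest: G.in_arcsD1 G.in_arcsD2 H.in_arcsD1 H.in_arcsD2)
  have fin: "finite (parcs (cartesian_product G H))"
    by (rule finite_subset[OF sub]) (simp add: G.pair_finite_verts H.pair_finite_verts)
  show ?thesis
  proof unfold_locales
    show "finite (parcs (cartesian_product G H))" by (rule fin)
    show "finite (pverts (cartesian_product G H))"
      by (simp add: cartesian_product_def G.pair_finite_verts H.pair_finite_verts)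
    show "symmetric (with_proj (cartesian_product G H))"
      by (auto simp: symmetric_def sym_def cartesian_product_def intro: sG sH)
    fix e assume e: "e \<in> parcs (cartesian_product G H)"
    show "fst e \<in> pverts (cartesian_product G H)" "snd e \<in> pverts (cartesian_product G H)"
      using subsetD[OF sub e] by (auto simp: cartesian_product_def)
    show "fst e \<noteq> snd e"
      using e G.pair_no_loops H.pair_no_loops by (fastforce simp: cartesian_product_def)
  qed
qed

end

theory Submission
  imports Defs
begin

text \<open>If \<open>k = n\<close> then the third family of generators contains, for each vertex \<open>w\<close>, the sum of all edge
  variables at \<open>w\<close>. In characteristic zero a sum of idempotents vanishes only if every summand does,
  so the ideal contains all edge variables, and the last family of generators collapses to
  \<open>1 - x\<^sub>g\<^sub>h\<close>. A graph whose domination number is its number of vertices has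
  no edges, and the product of two edgeless graphs is edgeless.\<close>

section \<open>Ideals of a subring and sums of idempotents\<close>

locale subring_ideal = ideal J "ring_of_type_algebra\<lparr>carrier := R\<rparr>"
  for R J :: "'p::comm_ring_1 set"
begin

text \<open>The record operations are those of the type \<open>'p\<close>, so these facts turn ideal
  membership into type class arithmetic.\<close>

lemma zero_mem: "0 \<in> J"
  and one_carrier: "1 \<in> R"
  and mem_carrier: "a \<in> J \<Longrightarrow> a \<in> R"
  and add_mem: "a \<in> J \<Longrightarrow> b \<in> J \<Longrightarrow> a + b \<in> J"
  and add_carrier: "a \<in> R \<Longrightarrow> b \<in> R \<Longrightarrow> a + b \<in> R"
  and mult_carrier: "a \<in> R \<Longrightarrow> b \<in> R \<Longrightarrow> a * b \<in> R"
  and mult_mem: "a \<in> J \<Longrightarrow> r \<in> R \<Longrightarrow> r * a \<in> J"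
  using additive_subgroup.zero_closed[OF is_additive_subgroup] one_closed a_subset
    additive_subgroup.a_closed[OF is_additive_subgroup, of a b] add.m_closed[of a b]
    m_closed[of a b] I_l_closed[of a r]
  by (auto simp: ring_of_type_algebra_def)

lemma mult_mem_right: "a \<in> J \<Longrightarrow> r \<in> R \<Longrightarrow> a * r \<in> J"
  using mult_mem by (simp add: mult.commute)

lemma uminus_one_carrier: "- 1 \<in> R"
proof -
  obtain y where "y \<in> R" "y + 1 = 0"
    using add.l_inv_ex[of 1] one_carrier by (auto simp: ring_of_type_algebra_def)
  then show ?thesis by (metis add_eq_0_iff2)
qed

lemma uminus_mem: "a \<in> J \<Longrightarrow> - a \<in> J"
  using mult_mem[OF _ uminus_one_carrier] by simp

lemma uminus_carrier: "a \<in> R \<Longrightarrow> - a \<in> R"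
  using mult_carrier[OF uminus_one_carrier] by simp

lemma diff_mem: "a \<in> J \<Longrightarrow> b \<in> J \<Longrightarrow> a - b \<in> J"
  using add_mem[OF _ uminus_mem, of a b] by simp

lemma sum_mem: "(\<And>i. i \<in> A \<Longrightarrow> f i \<in> J) \<Longrightarrow> sum f A \<in> J"
  by (induction A rule: infinite_finite_induct) (auto intro: zero_mem add_mem)

text \<open>Each factor is congruent to \<open>1\<close> modulo \<open>J\<close>. For infinite
  \<open>A\<close> the product has the default value \<open>1\<close>, so the difference is
  \<open>0\<close>.\<close>

lemma prod_one_minus_congruent_one:
  assumes "\<And>i. i \<in> A \<Longrightarrow> f i \<in> J"
  shows "(\<Prod>i\<in>A. 1 - f i) - 1 \<in> J"
  using assms
proof (induction A rule: infinite_finite_induct)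
  case (insert a A)
  let ?q = "\<Prod>i\<in>A. 1 - f i"
  have q: "?q - 1 \<in> J" using insert by auto
  have "1 - f a \<in> R"
    using add_carrier[OF one_carrier uminus_carrier, of "f a"] insert.prems mem_carrier by simp
  then have "(1 - f a) * (?q - 1) - f a \<in> J"
    using insert.prems by (intro diff_mem[OF mult_mem[OF q]]) auto
  then show ?case using insert by (simp add: algebra_simps)
qed (auto intro: zero_mem)

text \<open>Multiplying by an idempotent \<open>e\<close> turns \<open>c + e + t\<close> into \<open>e (c + 1 + t)\<close>, which is why the lemma
  is stated for a variable positive integer \<open>c\<close>.\<close>

lemma mem_if_mult_sum_idempotents_mem:
  assumes tf: "\<And>n z. 0 < n \<Longrightarrow> z \<in> R \<Longrightarrow> of_nat n * z \<in> J \<Longrightarrow> z \<in> J"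
    and "finite A" "0 < c" "z \<in> R"
    and "\<And>i. i \<in> A \<Longrightarrow> e i \<in> R" "\<And>i. i \<in> A \<Longrightarrow> (e i)\<^sup>2 - e i \<in> J"
    and "z * (of_nat c + sum e A) \<in> J"
  shows "z \<in> J"
  using assms(2-)
proof (induction A arbitrary: c z rule: finite_induct)
  \<comment> \<open>Only \<open>z * of_nat c\<close> remains; \<open>tf\<close> cancels the positive
    integer \<open>c\<close>.\<close>
  case empty
  then show ?case using tf[of c z] by (simp add: mult.commute)
next
  case (insert a A)
  let ?t = "sum e A" and ?e = "e a"
  have e: "?e \<in> R" and id: "?e\<^sup>2 - ?e \<in> J"
    using insert.prems by auto
  have s: "z * (of_nat c + (?e + ?t)) \<in> J" using insert by simp
  \<comment> \<open>Modulo \<open>J\<close>, \<open>z * ?e\<^sup>2\<close> may be replaced by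
    \<open>z * ?e\<close>, so the product with \<open>?e\<close> again has the shape of the
    hypothesis, with \<open>z * ?e\<close> for \<open>z\<close> and \<open>Suc c\<close> for
    \<open>c\<close>.\<close>
  have "?e * (z * (of_nat c + (?e + ?t))) - z * (?e\<^sup>2 - ?e) \<in> J"
    by (intro diff_mem mult_mem s e id insert.prems)
  moreover have "?e * (z * (of_nat c + (?e + ?t))) - z * (?e\<^sup>2 - ?e) = (z * ?e) * (of_nat (Suc c) + ?t)"
    by (simp add: algebra_simps power2_eq_square)
  ultimately have "(z * ?e) * (of_nat (Suc c) + ?t) \<in> J" by metis
  then have ze: "z * ?e \<in> J"
    by (rule insert.IH[of "Suc c", rotated -1]) (use insert.prems e in \<open>auto intro: mult_carrier\<close>)
  have "z * (of_nat c + (?e + ?t)) - z * ?e \<in> J" by (intro diff_mem s ze)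
  then have "z * (of_nat c + ?t) \<in> J" by (simp add: algebra_simps)
  then show ?case by (rule insert.IH[rotated -1]) (use insert.prems in auto)
qed

text \<open>Multiplying the sum by \<open>e a\<close> turns the summand \<open>e a\<close> into
  \<open>1\<close> modulo \<open>J\<close>, which is the previous lemma for \<open>z = e a\<close>,
  \<open>c = 1\<close> and the remaining summands.\<close>

lemma summand_mem_if_sum_idempotents_mem:
  assumes tf: "\<And>n z. 0 < n \<Longrightarrow> z \<in> R \<Longrightarrow> of_nat n * z \<in> J \<Longrightarrow> z \<in> J"
    and "finite A" "a \<in> A"
    and e: "\<And>i. i \<in> A \<Longrightarrow> e i \<in> R" "\<And>i. i \<in> A \<Longrightarrow> (e i)\<^sup>2 - e i \<in> J"
    and s: "sum e A \<in> J"
  shows "e a \<in> J"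
proof (rule mem_if_mult_sum_idempotents_mem[OF tf, where A = "A - {a}" and c = 1 and e = e])
  have "e a * sum e A - ((e a)\<^sup>2 - e a) \<in> J"
    by (intro diff_mem[OF mult_mem[OF s]] e assms(3))
  then show "e a * (of_nat 1 + sum e (A - {a})) \<in> J"
    using sum.remove[OF assms(2,3), of e] by (simp add: algebra_simps power2_eq_square)
qed (use assms(2-) in auto)

lemma edge_mem_if_graph_gens_mem:
  assumes tf: "\<And>n z. 0 < n \<Longrightarrow> z \<in> R \<Longrightarrow> of_nat n * z \<in> J \<Longrightarrow> z \<in> J"
    and "finite V" "graph_gens e V D (card V) \<subseteq> J"
    and e: "\<And>v w. v \<in> V \<Longrightarrow> w \<in> V \<Longrightarrow> v \<noteq> w \<Longrightarrow> e v w \<in> R"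
    and v: "v \<in> V" and w: "w \<in> V" and "v \<noteq> w"
  shows "e v w \<in> J"
proof (rule summand_mem_if_sum_idempotents_mem[OF tf, where A = "V - {w}" and e = "\<lambda>v. e v w"])
  \<comment> \<open>For \<open>S = V - {w}\<close> the complement is \<open>{w}\<close>, so the
    generator is a product with a single factor: the sum of the edge variables at
    \<open>w\<close>.\<close>
  have "card (V - {w}) + 1 = card V" using w \<open>finite V\<close> by (metis Suc_eq_plus1 card.remove)
  then have "(\<Prod>u\<in>V - (V - {w}). \<Sum>v\<in>V - {w}. e v u) \<in> graph_gens e V D (card V)"
    unfolding graph_gens_def by blast
  moreover have "V - (V - {w}) = {w}" using w by auto
  ultimately show "(\<Sum>v\<in>V - {w}. e v w) \<in> J" using assms(3) by auto
next
  fix i assume "i \<in> V - {w}"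
  then have "(e i w)\<^sup>2 - e i w \<in> graph_gens e V D (card V)"
    using w unfolding graph_gens_def by blast
  then show "(e i w)\<^sup>2 - e i w \<in> J" using assms(3) by auto
qed (use assms(2-) in auto)

end

section \<open>The Vizing ideal over a subfield of the reals\<close>

lemma polys_over_scaled_ideal_mem:
  assumes K: "subfield K (ring_of_type_algebra :: real ring)"
    and J: "subring_ideal (polys_over K Z) J"
    and n: "0 < n" and z: "of_nat n * z \<in> J"
  shows "z \<in> J"
proof -
  interpret subring_ideal "polys_over K Z" J by (rule J)
  \<comment> \<open>The field \<open>K\<close> contains \<open>n\<close> and hence its inverse
    \<open>y\<close>; multiplying by the constant polynomial \<open>y\<close> undoes the factor
    \<open>n\<close>. This provides the hypothesis \<open>tf\<close> of the lemmas above.\<close>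
  have "of_nat n \<in> K"
    by (induction n) (auto intro: subfield_real_closed[OF K])
  then have "real n \<in> Units ((ring_of_type_algebra :: real ring)\<lparr>carrier := K\<rparr>)"
    using n subfield.subfield_Units[OF K] by (simp add: ring_of_type_algebra_def)
  then obtain y where y: "y \<in> K" "y * real n = 1"
    by (auto simp: Units_def ring_of_type_algebra_def)
  have "Poly_Mapping.single 0 y * (of_nat n * z) \<in> J"
    by (intro mult_mem z polys_over_const[OF K] y)
  moreover have "Poly_Mapping.single 0 y * of_nat n = (1 :: 'a rpoly)"
    using y by (simp flip: single_of_nat single_one add: mult_single)
  ultimately show ?thesis by (simp flip: mult.assoc)
qed

lemma viz_poly_mem_viz_ideal:
  fixes VG DG :: "'g set" and VH DH :: "'h set"
  assumes K: "subfield K (ring_of_type_algebra :: real ring)"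
    and "finite VG" "DG \<subseteq> VG" "finite VH" "DH \<subseteq> VH"
  shows "viz_poly VG (card VG) VH (card VH) \<in> viz_ideal K VG DG (card VG) VH DH (card VH)"
proof -
  let ?R = "polys_over K (viz_vars VG VH)"
  let ?A = "graph_gens eG VG DG (card VG) \<union> graph_gens eH VH DH (card VH) \<union> cross_gens VG VH"
  let ?J = "viz_ideal K VG DG (card VG) VH DH (card VH)"
  interpret P: cring "viz_ring K VG VH"
    unfolding viz_ring_def by (rule cring_poly_ring_over[OF K])
  have A: "?A \<subseteq> carrier (viz_ring K VG VH)" by (rule viz_gens_carrier[OF K assms(3,5)])
  have gens: "?A \<subseteq> ?J"
    unfolding viz_ideal_def by (rule P.genideal_self[OF A])
  have J: "subring_ideal ?R ?J"
    unfolding subring_ideal_def using P.genideal_ideal[OF A]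
    by (simp add: viz_ideal_def viz_ring_def poly_ring_over_def)
  interpret subring_ideal ?R ?J by (rule J)
  have tf: "z \<in> ?J" if "0 < n" "z \<in> ?R" "of_nat n * z \<in> ?J" for n z
    using polys_over_scaled_ideal_mem[OF K J] that by auto
  have eG: "eG g g' \<in> ?J" if "g \<in> VG" "g' \<in> VG" "g \<noteq> g'" for g g'
  proof (rule edge_mem_if_graph_gens_mem[OF tf, where e = eG and V = VG and D = DG])
    show "graph_gens eG VG DG (card VG) \<subseteq> ?J" using gens by auto
  qed (use that assms(2,4) in \<open>auto simp: eG_def viz_vars_def intro!: polys_over_pvar[OF K]\<close>)
  have eH: "eH h h' \<in> ?J" if "h \<in> VH" "h' \<in> VH" "h \<noteq> h'" for h h'
  proof (rule edge_mem_if_graph_gens_mem[OF tf, where e = eH and V = VH and D = DH])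
    show "graph_gens eH VH DH (card VH) \<subseteq> ?J" using gens by auto
  qed (use that assms(2,4) in \<open>auto simp: eH_def viz_vars_def intro!: polys_over_pvar[OF K]\<close>)
  have xR: "xGH g h \<in> ?R" if "g \<in> VG" "h \<in> VH" for g h
    using that by (auto simp: xGH_def viz_vars_def intro!: polys_over_pvar[OF K])
  have x: "xGH g h - 1 \<in> ?J" if g: "g \<in> VG" and h: "h \<in> VH" for g h
  proof -
    let ?p = "\<Prod>g'\<in>VG - {g}. 1 - eG g g' * xGH g' h"
    let ?q = "\<Prod>h'\<in>VH - {h}. 1 - eH h h' * xGH g h'"
    let ?y = "1 - xGH g h"
    have p: "?p - 1 \<in> ?J"
      using g h by (intro prod_one_minus_congruent_one) (auto intro!: mult_mem_right eG xR)
    have q: "?q - 1 \<in> ?J"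
      using g h by (intro prod_one_minus_congruent_one) (auto intro!: mult_mem_right eH xR)
    have y: "?y \<in> ?R" by (intro polys_over_diff[OF K] polys_over_one[OF K] xR g h)
    \<comment> \<open>\<open>?p\<close> is \<open>(?p - 1) + 1\<close>, and \<open>?J\<close> lies
      inside \<open>?R\<close>.\<close>
    have "?p \<in> ?R" using polys_over_add[OF K mem_carrier[OF p] one_carrier] by simp
    then have "?y * ?p \<in> ?R" using y by (intro mult_carrier)
    moreover have "?y * ?p * ?q \<in> ?J"
    proof -
      have "?y * ?p * ?q \<in> cross_gens VG VH"
        using g h unfolding cross_gens_def by blast
      then show ?thesis using gens by blast
    qed
    \<comment> \<open>The combination telescopes to \<open>- ?y\<close>, which is
      \<open>xGH g h - 1\<close>.\<close>
    ultimately have "(?y * ?p) * (?q - 1) + ?y * (?p - 1) - ?y * ?p * ?q \<in> ?J"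
      by (intro diff_mem[OF add_mem[OF mult_mem[OF q] mult_mem[OF p y]]])
    then show ?thesis by (simp add: algebra_simps)
  qed
  \<comment> \<open>The constant \<open>card VG * card VH\<close> provides exactly one
    \<open>1\<close> for each pair of vertices.\<close>
  have "viz_poly VG (card VG) VH (card VH) = (\<Sum>g\<in>VG. \<Sum>h\<in>VH. xGH g h - 1)"
    by (simp add: viz_poly_def sum_subtractf)
  then show ?thesis by (auto intro!: sum_mem x)
qed

section \<open>Domination numbers of edgeless graphs\<close>

lemma domination_number_le_card:
  assumes "finite (pverts G)" "dominating_set G D"
  shows "domination_number G \<le> card D"
proof -
  have "{card D |D. dominating_set G D} \<subseteq> card ` Pow (pverts G)"
    by (auto simp: dominating_set_def)
  then have "finite {card D |D. dominating_set G D}"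
    by (rule finite_subset) (simp add: assms(1))
  then show ?thesis
    unfolding domination_number_def using assms(2) by (intro Min_le) auto
qed

text \<open>If there were an arc \<open>(u, v)\<close>, then all vertices but \<open>v\<close> would
  still dominate, as \<open>u\<close> remains a neighbour of \<open>v\<close>.\<close>

lemma no_arcs_if_domination_number_eq_card:
  assumes "pair_graph G" "domination_number G = card (pverts G)"
  shows "parcs G = {}"
proof (rule ccontr)
  interpret pair_graph G by fact
  assume "parcs G \<noteq> {}"
  then obtain u v where uv: "(u, v) \<in> parcs G" by auto
  have u: "u \<in> pverts G" and v: "v \<in> pverts G" and "u \<noteq> v"
    using uv pair_no_loops[OF uv] by (auto dest: in_arcsD1 in_arcsD2)
  then have "dominating_set G (pverts G - {v})"
    using uv by (auto simp: dominating_set_def)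
  then have "card (pverts G) \<le> card (pverts G - {v})"
    unfolding assms(2)[symmetric] by (rule domination_number_le_card[OF pair_finite_verts])
  then show False using card_Diff1_less[OF pair_finite_verts v] by simp
qed

text \<open>A vertex outside a dominating set needs an arc, so only the full vertex set
  dominates.\<close>

lemma domination_number_no_arcs:
  assumes "parcs G = {}"
  shows "domination_number G = card (pverts G)"
proof -
  have "dominating_set G D \<longleftrightarrow> D = pverts G" for D
    unfolding dominating_set_def assms by blast
  then show ?thesis by (simp add: domination_number_def)
qed

theorem theorem5p11:
  fixes K :: "real set"
    and VG DG :: "'g set" and VH DH :: "'h set"
    and nG kG nH kH :: nat
  assumes "subfield K (ring_of_type_algebra :: real ring)"
    and "finite VG" and "card VG = nG" and "DG \<subseteq> VG" and "card DG = kG"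
    and "finite VH" and "card VH = nH" and "DH \<subseteq> VH" and "card DH = kH"
    and "kG = nG" and "nG \<ge> 1" and "kH = nH" and "nH \<ge> 1"
  shows "sos_certificate (viz_ring K VG VH) (viz_ideal K VG DG kG VH DH kH) 0
           (viz_poly VG kG VH kH) VG (\<lambda>g. 0)
       \<and> viz_poly VG kG VH kH \<in> viz_ideal K VG DG kG VH DH kH
       \<and> (\<forall>(G :: 'c pair_pre_digraph) (H :: 'd pair_pre_digraph).
            pair_graph G \<and> domination_number G = card (pverts G) \<and> card (pverts G) = nG \<and>
            pair_graph H \<and> domination_number H = card (pverts H) \<and> card (pverts H) = nH \<longrightarrow>
            domination_number G * domination_number H
              \<le> domination_number (cartesian_product G H))"
proof -
  have "DG = VG" "DH = VH" using assms by (metis card_subset_eq)+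
  then have mem: "viz_poly VG kG VH kH \<in> viz_ideal K VG DG kG VH DH kH"
    using viz_poly_mem_viz_ideal[OF assms(1,2,4,6,8)] assms by simp
  \<comment> \<open>The squares sum to \<open>0\<close>, so this is the membership
    \<open>mem\<close>; the degree bound holds because the zero polynomial has degree
    \<open>0\<close>.\<close>
  have "sos_certificate (viz_ring K VG VH) (viz_ideal K VG DG kG VH DH kH) 0
      (viz_poly VG kG VH kH) VG (\<lambda>g. 0)"
    using mem assms polys_over_zero[OF assms(1), of "viz_vars VG VH"]
    by (simp add: sos_certificate_def total_degree_def viz_ring_def poly_ring_over_def)
  moreover have "domination_number G * domination_number H
      \<le> domination_number (cartesian_product G H)"
    if "pair_graph G" "domination_number G = card (pverts G)"
      "pair_graph H" "domination_number H = card (pverts H)"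
    for G :: "'c pair_pre_digraph" and H :: "'d pair_pre_digraph"
  proof -
    \<comment> \<open>The inequality is obtained on the graphs directly: both factors are edgeless,
      hence so is the product, and both sides equal the number of pairs of vertices.\<close>
    have "parcs (cartesian_product G H) = {}"
      using that by (simp add: cartesian_product_def no_arcs_if_domination_number_eq_card)
    then show ?thesis
      using that by (simp add: domination_number_no_arcs) (simp add: cartesian_product_def card_cartesian_product)
  qed
  ultimately show ?thesis using mem by blast
qed

end
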